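(* Let $R=\mathbb{F}_2\langle a,x : a=a^2x\rangle$. Then $\mathrm{N}(R)=\mathrm{N}^r_R(a)$. In particular, $R$ is an NR ring.
   Context: $R=\mathbb{F}_2\langle a,x: a=a^2x\rangle$ denotes the quotient of the free unital associative (noncommutative) $\mathbb{F}_2$-algebra on two generators $a,x$ by the two-sided ideal generated by $a-a^2x$. $\mathrm{N}(R)$ is the set of nilpotent elements of $R$. For a ring $R$ and $a\in R$, $\mathrm{N}^r_R(a)$ is the set of nilpotent elements $r\in R$ for which there exist elements $r_i\in R$ ($i=1,2,3,\ldots$) such that $r=r_1a$, $ar_i=r_{i+1}a$ for all $i\geq 1$, and $ar_k=0$ for some $k\ge1$. A ring is NR if its set of nilpotent elements is a subring (not necessarily containing $1$). *)

theory Defs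
  imports "HOL-Library.Poly_Mapping" "HOL-Library.Z2" "HOL.Hull"
begin

section \<open>Nilpotent elements\<close>

definition nilpotents :: "'a::ring_1 set" where
  "nilpotents = {r. \<exists>n\<ge>1. r ^ n = 0}"

definition Nr :: "'a::ring_1 \<Rightarrow> 'a set" where
  "Nr a = {r \<in> nilpotents. \<exists>s :: nat \<Rightarrow> 'a.
     r = s 1 * a \<and> (\<forall>i\<ge>1. a * s i = s (i + 1) * a) \<and> (\<exists>k\<ge>1. a * s k = 0)}"

definition nonunital_subring :: "'a::ring_1 set \<Rightarrow> bool" where
  "nonunital_subring S \<longleftrightarrow> 0 \<in> S \<and> (\<forall>x\<in>S. \<forall>y\<in>S. x - y \<in> S \<and> x * y \<in> S)"

definition NR_ring :: "'a::ring_1 itself \<Rightarrow> bool" where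
  "NR_ring (_ :: 'a itself) \<longleftrightarrow> nonunital_subring (nilpotents :: 'a set)"

section \<open>Free algebras and two-sided ideals\<close>

text \<open>The free monoid is written additively, because the product of
  \<^typ>\<open>'m \<Rightarrow>\<^sub>0 'k\<close> is the convolution product of the monoid algebra
  of an additively written monoid \<open>'m\<close>.\<close>

datatype 'g free_monoid = Word (letters: "'g list")

instantiation free_monoid :: (type) monoid_add
begin

definition zero_free_monoid :: "'a free_monoid" where
  "0 = Word []"

definition plus_free_monoid :: "'a free_monoid \<Rightarrow> 'a free_monoid \<Rightarrow> 'a free_monoid" where
  "u + v = Word (letters u @ letters v)"

instance
  by standard (simp_all add: zero_free_monoid_def plus_free_monoid_def)

end

type_synonym ('k, 'g) free_algebra = "'g free_monoid \<Rightarrow>\<^sub>0 'k"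

definition gen :: "'g \<Rightarrow> ('k::ring_1, 'g) free_algebra" where
  "gen g = Poly_Mapping.single (Word [g]) 1"

definition two_sided_ideal :: "'a::ring_1 set \<Rightarrow> bool" where
  "two_sided_ideal I \<longleftrightarrow>
     0 \<in> I \<and> (\<forall>p\<in>I. \<forall>q\<in>I. p + q \<in> I) \<and> (\<forall>r. \<forall>p\<in>I. r * p \<in> I \<and> p * r \<in> I)"

lemma two_sided_ideal_hull: "two_sided_ideal (two_sided_ideal hull S)"
  by (rule hull_in) (auto simp: two_sided_ideal_def)

lemma two_sided_ideal_uminus:
  assumes "two_sided_ideal I" "p \<in> I"
  shows "- p \<in> I"
proof -
  have "(- 1) * p \<in> I"
    using assms unfolding two_sided_ideal_def by blast
  then show ?thesis by simp
qed

section \<open>The ring \<open>\<bbbF>\<^sub>2\<langle>a, x : a = a\<^sup>2x\<rangle>\<close>\<close>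

datatype generator = A | X

definition R_ideal :: "(bit, generator) free_algebra set" where
  "R_ideal = two_sided_ideal hull {gen A - (gen A)\<^sup>2 * gen X}"

lemma R_ideal: "two_sided_ideal R_ideal"
  unfolding R_ideal_def by (rule two_sided_ideal_hull)

lemma R_ideal_zero: "0 \<in> R_ideal"
  and R_ideal_add: "p \<in> R_ideal \<Longrightarrow> q \<in> R_ideal \<Longrightarrow> p + q \<in> R_ideal"
  and R_ideal_mult_left: "p \<in> R_ideal \<Longrightarrow> r * p \<in> R_ideal"
  and R_ideal_mult_right: "p \<in> R_ideal \<Longrightarrow> p * r \<in> R_ideal"
  and R_ideal_uminus: "p \<in> R_ideal \<Longrightarrow> - p \<in> R_ideal"
  using R_ideal two_sided_ideal_uminus[OF R_ideal] by (auto simp: two_sided_ideal_def)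

quotient_type R = "(bit, generator) free_algebra" / "\<lambda>p q. p - q \<in> R_ideal"
proof (rule equivpI)
  show "reflp (\<lambda>p q. p - q \<in> R_ideal)"
    by (rule reflpI) (simp add: R_ideal_zero)
  show "symp (\<lambda>p q. p - q \<in> R_ideal)"
    by (rule sympI) (metis R_ideal_uminus minus_diff_eq)
  show "transp (\<lambda>p q. p - q \<in> R_ideal)"
    by (rule transpI) (metis R_ideal_add diff_add_cancel add_diff_eq)
qed

text \<open>The constant coefficient is multiplicative, so it separates \<open>0\<close> and \<open>1\<close> in the quotient.\<close>

lemma lookup_mult_zero:
  fixes p q :: "('k::ring_1, 'g) free_algebra"
  shows "Poly_Mapping.lookup (p * q) 0 = Poly_Mapping.lookup p 0 * Poly_Mapping.lookup q 0"
proof -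
  have *: "u + v = 0 \<longleftrightarrow> u = 0 \<and> v = 0" for u v :: "'g free_monoid"
    by (cases u; cases v) (auto simp: zero_free_monoid_def plus_free_monoid_def)
  have **: "(\<Sum>v. Poly_Mapping.lookup q v when u + v = 0) = (Poly_Mapping.lookup q 0 when u = 0)" for u
    by (cases "u = 0") (simp_all add: *)
  show ?thesis
    by (simp add: lookup_mult eq_commute[of 0] ** mult_when)
qed

lemma one_notin_R_ideal: "1 \<notin> R_ideal"
proof
  let ?K = "{p :: (bit, generator) free_algebra. Poly_Mapping.lookup p 0 = 0}"
  assume "1 \<in> R_ideal"
  moreover have "R_ideal \<subseteq> ?K"
    unfolding R_ideal_def
  proof (rule hull_minimal)
    have "Poly_Mapping.lookup (gen A :: (bit, generator) free_algebra) 0 = 0"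
      by (simp add: gen_def lookup_single zero_free_monoid_def)
    then show "{gen A - (gen A)\<^sup>2 * gen X} \<subseteq> ?K"
      by (simp add: lookup_minus lookup_mult_zero power2_eq_square)
    show "two_sided_ideal ?K"
      by (simp add: two_sided_ideal_def lookup_add lookup_mult_zero)
  qed
  ultimately show False
    by (auto simp: lookup_one)
qed

instantiation R :: ring_1
begin

lift_definition zero_R :: R is 0 .
lift_definition one_R :: R is 1 .

lift_definition plus_R :: "R \<Rightarrow> R \<Rightarrow> R" is "(+)"
proof -
  fix p p' q q' :: "(bit, generator) free_algebra"
  assume "p - p' \<in> R_ideal" "q - q' \<in> R_ideal"
  then have "(p - p') + (q - q') \<in> R_ideal" by (rule R_ideal_add)
  then show "p + q - (p' + q') \<in> R_ideal" by (simp add: algebra_simps)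
qed

lift_definition uminus_R :: "R \<Rightarrow> R" is uminus
proof -
  fix p p' :: "(bit, generator) free_algebra"
  assume "p - p' \<in> R_ideal"
  then have "- (p - p') \<in> R_ideal" by (rule R_ideal_uminus)
  then show "- p - - p' \<in> R_ideal" by simp
qed

lift_definition minus_R :: "R \<Rightarrow> R \<Rightarrow> R" is "(-)"
proof -
  fix p p' q q' :: "(bit, generator) free_algebra"
  assume "p - p' \<in> R_ideal" "q - q' \<in> R_ideal"
  then have "(p - p') + - (q - q') \<in> R_ideal" by (intro R_ideal_add R_ideal_uminus)
  then show "p - q - (p' - q') \<in> R_ideal" by (simp add: algebra_simps)
qed

lift_definition times_R :: "R \<Rightarrow> R \<Rightarrow> R" is "(*)"
proof -
  fix p p' q q' :: "(bit, generator) free_algebra"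
  assume "p - p' \<in> R_ideal" "q - q' \<in> R_ideal"
  then have "(p - p') * q + p' * (q - q') \<in> R_ideal"
    by (intro R_ideal_add R_ideal_mult_left R_ideal_mult_right)
  then show "p * q - p' * q' \<in> R_ideal" by (simp add: algebra_simps)
qed

instance
  by standard
    (transfer; simp add: algebra_simps R_ideal_zero;
      use one_notin_R_ideal R_ideal_uminus in fastforce)+

end

lift_definition a_R :: R is "gen A" .

end

theory Submission
  imports Defs
begin

text \<open>The relation \<open>a = a\<^sup>2x\<close> equates two words, so \<open>R\<close> is the algebra of a monoid. Rewriting
  \<open>aax\<close> to \<open>a\<close> has no critical pairs, and the irreducible words are exactly the words
  \<open>w a\<^sup>n\<close> with \<open>w\<close> a product of blocks \<open>x\<close> and \<open>ax\<close>. The multiplication of these normal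
  forms is realised as an instance of \<^class>\<open>monoid_add\<close>, and \<open>to_nf\<close> maps \<open>R\<close>
  injectively into the corresponding monoid algebra. This makes questions about \<open>R\<close>
  questions about coefficients of normal forms; for instance, the left ideal \<open>Ra\<close> consists of the
  elements that have no term \<open>w a\<^sup>0\<close>, and right multiplication by \<open>a\<close> is injective.

  The key point is that \<open>Ra\<close> is completely prime: if \<open>y\<close> and \<open>f\<close> are not in \<open>Ra\<close>, then neither
  is \<open>y f\<close> (\<open>has_exponent_zero_mult\<close>). Hence every nilpotent \<open>r\<close> lies in \<open>Ra\<close>. If
  \<open>r = r\<^sub>1 a\<close> is nilpotent, then so is \<open>a r\<^sub>1\<close>, which therefore is \<open>r\<^sub>2 a\<close> for some \<open>r\<^sub>2\<close>, and so on: the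
  sequence required by the definition of \<open>Nr a\<close> exists. It satisfies
  \<open>a\<^sup>k r = r\<^bsub>k+1\<^esub> a\<^bsup>k+1\<^esup>\<close>.

  That the sequence reaches \<open>0\<close> follows from the homomorphism from \<open>R\<close> to the Laurent polynomials
  in one variable that sends \<open>a\<close> to the variable and \<open>x\<close> to its inverse. Its target is a
  domain, so it kills \<open>r\<close>; and every element of its kernel is annihilated from the left by a power
  of \<open>a\<close>, because \<open>a\<^sup>k u = a\<^bsup>k + deg u\<^esup>\<close> for each word \<open>u\<close> shorter than \<open>k\<close>. So
  \<open>r\<^bsub>k+1\<^esub> a\<^bsup>k+1\<^esup> = 0\<close> for large \<open>k\<close>, and \<open>r\<^bsub>k+1\<^esub> = 0\<close> by cancellation.

  Finally, in any ring the set \<open>Nr a\<close> is closed under differences and products, because the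
  sequences can be combined termwise; thus \<open>R\<close> is an NR ring.\<close>

section \<open>Monoid algebras\<close>

text \<open>A leading-term argument without a monomial order: all that matters is that no
  other pair of monomials from the supports of the two factors has the same product as \<open>u\<^sub>0\<close> and \<open>v\<^sub>0\<close>.\<close>

lemma lookup_mult_unique:
  fixes y f :: "'m::monoid_add \<Rightarrow>\<^sub>0 'k::semiring_0"
  assumes unique: "\<And>u v. \<lbrakk>u \<in> Poly_Mapping.keys y; v \<in> Poly_Mapping.keys f; u + v = u\<^sub>0 + v\<^sub>0\<rbrakk>
    \<Longrightarrow> u = u\<^sub>0 \<and> v = v\<^sub>0"
  shows "Poly_Mapping.lookup (y * f) (u\<^sub>0 + v\<^sub>0) = Poly_Mapping.lookup y u\<^sub>0 * Poly_Mapping.lookup f v\<^sub>0"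
proof -
  have "Poly_Mapping.lookup y u * (\<Sum>v. Poly_Mapping.lookup f v when u\<^sub>0 + v\<^sub>0 = u + v)
      = (Poly_Mapping.lookup y u\<^sub>0 * Poly_Mapping.lookup f v\<^sub>0 when u = u\<^sub>0)" for u
  proof (cases "u \<in> Poly_Mapping.keys y")
    case True
    have "(Poly_Mapping.lookup f v when u\<^sub>0 + v\<^sub>0 = u + v)
        = ((Poly_Mapping.lookup f v\<^sub>0 when u = u\<^sub>0) when v = v\<^sub>0)" for v
    proof (cases "v \<in> Poly_Mapping.keys f \<and> u + v = u\<^sub>0 + v\<^sub>0")
      case v: True
      then have "u = u\<^sub>0 \<and> v = v\<^sub>0" using unique[OF True] by blast
      then show ?thesis by simp
    next
      case False
      then consider "Poly_Mapping.lookup f v = 0" | "u\<^sub>0 + v\<^sub>0 \<noteq> u + v"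
        by (metis in_keys_iff)
      then show ?thesis by cases (cases "v = v\<^sub>0"; cases "u = u\<^sub>0"; simp)+
    qed
    then have "(\<Sum>v. Poly_Mapping.lookup f v when u\<^sub>0 + v\<^sub>0 = u + v)
        = (\<Sum>v. (Poly_Mapping.lookup f v\<^sub>0 when u = u\<^sub>0) when v = v\<^sub>0)"
      by presburger
    also have "\<dots> = (Poly_Mapping.lookup f v\<^sub>0 when u = u\<^sub>0)"
      by (rule Sum_any_when_equal)
    finally show ?thesis by (cases "u = u\<^sub>0") simp_all
  next
    case False
    then show ?thesis by (cases "u = u\<^sub>0") (simp_all add: in_keys_iff)
  qed
  then have "Poly_Mapping.lookup (y * f) (u\<^sub>0 + v\<^sub>0)
      = (\<Sum>u. Poly_Mapping.lookup y u\<^sub>0 * Poly_Mapping.lookup f v\<^sub>0 when u = u\<^sub>0)"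
    unfolding lookup_mult by presburger
  also have "\<dots> = Poly_Mapping.lookup y u\<^sub>0 * Poly_Mapping.lookup f v\<^sub>0"
    by (rule Sum_any_when_equal)
  finally show ?thesis .
qed

text \<open>For a monoid homomorphism \<open>h\<close> this is the induced homomorphism of monoid algebras. It is also
  applied to maps \<open>h\<close> that are not homomorphisms, such as the choice of a word for each normal form.\<close>

definition push_forward :: "('m \<Rightarrow> 'n) \<Rightarrow> ('m \<Rightarrow>\<^sub>0 'k::comm_monoid_add) \<Rightarrow> ('n \<Rightarrow>\<^sub>0 'k)" where
  "push_forward h p = (\<Sum>u\<in>Poly_Mapping.keys p. Poly_Mapping.single (h u) (Poly_Mapping.lookup p u))"

lemma push_forward_superset:
  assumes "finite K" "Poly_Mapping.keys p \<subseteq> K"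
  shows "push_forward h p = (\<Sum>u\<in>K. Poly_Mapping.single (h u) (Poly_Mapping.lookup p u))"
  unfolding push_forward_def by (rule sum.mono_neutral_left) (use assms in \<open>auto simp: in_keys_iff\<close>)

lemma push_forward_zero [simp]: "push_forward h 0 = 0"
  by (simp add: push_forward_def)

lemma push_forward_single [simp]:
  "push_forward h (Poly_Mapping.single u c) = Poly_Mapping.single (h u) c"
  by (simp add: push_forward_superset[of "{u}"])

lemma push_forward_add: "push_forward h (p + q) = push_forward h p + push_forward h q"
proof -
  let ?K = "Poly_Mapping.keys p \<union> Poly_Mapping.keys q"
  have "Poly_Mapping.keys (p + q) \<subseteq> ?K" by (rule Poly_Mapping.keys_add)
  then show ?thesis
    by (simp add: push_forward_superset[of ?K] lookup_add single_add sum.distrib)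
qed

lemma push_forward_sum: "push_forward h (sum f I) = (\<Sum>i\<in>I. push_forward h (f i))"
  by (induction I rule: infinite_finite_induct) (simp_all add: push_forward_add)

lemma push_forward_diff:
  fixes p q :: "'m \<Rightarrow>\<^sub>0 'k::ab_group_add"
  shows "push_forward h (p - q) = push_forward h p - push_forward h q"
  using push_forward_add[of h "p - q" q] by (simp add: eq_diff_eq)

lemma push_forward_push_forward: "push_forward g (push_forward h p) = push_forward (g \<circ> h) p"
  by (simp add: push_forward_def[of h] push_forward_def[of "g \<circ> h"] push_forward_sum)

lemma push_forward_id: "push_forward (\<lambda>u. u) p = p"
  by (rule poly_mapping_eqI)
    (auto simp: push_forward_def lookup_sum lookup_single when_def in_keys_iff)

lemma push_forward_mult:
  fixes h :: "'m::monoid_add \<Rightarrow> 'n::monoid_add" and p q :: "'m \<Rightarrow>\<^sub>0 'k::semiring_1"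
  assumes hom: "\<And>u v. h (u + v) = h u + h v"
  shows "push_forward h (p * q) = push_forward h p * push_forward h q"
proof -
  have expand: "r = (\<Sum>u\<in>Poly_Mapping.keys r. Poly_Mapping.single u (Poly_Mapping.lookup r u))"
    for r :: "'m \<Rightarrow>\<^sub>0 'k"
    using push_forward_id[of r] by (simp add: push_forward_def)
  have "p * q = (\<Sum>u\<in>Poly_Mapping.keys p. \<Sum>v\<in>Poly_Mapping.keys q.
      Poly_Mapping.single (u + v) (Poly_Mapping.lookup p u * Poly_Mapping.lookup q v))"
    by (subst expand[of p], subst expand[of q]) (simp add: sum_product mult_single)
  then show ?thesis
    by (simp add: push_forward_sum hom)
      (simp add: push_forward_def sum_product mult_single)
qed

lemma push_forward_one:
  assumes "h 0 = 0"
  shows "push_forward h (1 :: 'm::monoid_add \<Rightarrow>\<^sub>0 'k::semiring_1) = 1"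
  by (simp add: assms flip: single_one)

section \<open>The monoid of normal forms\<close>

datatype block = Block_x | Block_ax

datatype normal_form = NF "block list" nat

text \<open>Left multiplication by \<open>a\<close>: leading blocks \<open>ax\<close> are absorbed by \<open>a(ax) = a\<close>, and \<open>a\<close> then
  joins the first block \<open>x\<close>, if there is one, or else the trailing power of \<open>a\<close>.\<close>

function lmul_a :: "normal_form \<Rightarrow> normal_form" where
  "lmul_a (NF [] n) = NF [] (Suc n)"
| "lmul_a (NF (Block_x # w) n) = NF (Block_ax # w) n"
| "lmul_a (NF (Block_ax # w) n) = lmul_a (NF w n)"
  by pat_completeness auto
termination by (relation "measure (\<lambda>v. case v of NF w n \<Rightarrow> length w)") auto

fun prepend :: "block list \<Rightarrow> normal_form \<Rightarrow> normal_form" where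
  "prepend w (NF w' n) = NF (w @ w') n"

lemma lmul_a_prepend_ax: "lmul_a (prepend (Block_ax # w) v) = lmul_a (prepend w v)"
  by (cases v) simp

lemma lmul_a_prepend_x: "lmul_a (prepend (Block_x # w) v) = prepend (Block_ax # w) v"
  by (cases v) simp

lemma prepend_Nil [simp]: "prepend [] v = v"
  by (cases v) simp

lemma prepend_append: "prepend (w @ w') v = prepend w (prepend w' v)"
  by (cases v) simp

instantiation normal_form :: monoid_add
begin

definition zero_normal_form :: normal_form where
  "0 = NF [] 0"

fun plus_normal_form :: "normal_form \<Rightarrow> normal_form \<Rightarrow> normal_form" where
  "NF w n + v = prepend w ((lmul_a ^^ n) v)"

lemma lmul_a_plus: "lmul_a u + v = lmul_a (u + v)" for u v :: normal_form
  by (induction u rule: lmul_a.induct)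
    (simp_all add: lmul_a_prepend_ax lmul_a_prepend_x)

lemma lmul_a_power_plus: "(lmul_a ^^ n) u + v = (lmul_a ^^ n) (u + v)" for u v :: normal_form
  by (induction n) (simp_all add: lmul_a_plus)

lemma prepend_plus: "prepend w u + v = prepend w (u + v)" for u v :: normal_form
  by (cases u) (simp add: prepend_append)

lemma lmul_a_power_Nil: "(lmul_a ^^ n) (NF [] m) = NF [] (n + m)"
  by (induction n) simp_all

instance
proof
  fix u v w :: normal_form
  show "u + v + w = u + (v + w)"
    by (cases u) (simp add: prepend_plus lmul_a_power_plus)
  show "0 + u = u" by (simp add: zero_normal_form_def)
  show "u + 0 = u"
    by (cases u) (simp add: zero_normal_form_def lmul_a_power_Nil)
qed

end

lemma plus_a: "NF w n + NF [] (Suc 0) = NF w (Suc n)"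
  by (simp add: lmul_a_power_Nil)

text \<open>Left multiplication by \<open>a\<close> avoids a trailing \<open>a\<close> only by turning a block \<open>x\<close> into \<open>ax\<close>, and
  everything to the right of this block stays as it was.\<close>

lemma lmul_a_eq_zero_exponent:
  "lmul_a (NF v m) = NF v' 0 \<Longrightarrow> m = 0 \<and> (\<exists>s t. v = s @ Block_x # t \<and> v' = Block_ax # t)"
proof (induction v)
  case (Cons b v)
  show ?case
  proof (cases b)
    case Block_x
    then show ?thesis using Cons.prems by (intro conjI exI[of _ "[]"] exI[of _ v]) auto
  next
    case Block_ax
    then show ?thesis using Cons by (metis append_Cons lmul_a.simps(3))
  qed
qed simp

text \<open>Each further factor \<open>a\<close> first absorbs the block \<open>ax\<close> made by the previous one and then
  converts a block \<open>x\<close> strictly to the right of it, so that only the last conversion remains visible.\<close>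

lemma lmul_a_power_eq_zero_exponent:
  "(lmul_a ^^ Suc n) (NF v m) = NF v' 0 \<Longrightarrow>
     m = 0 \<and> (\<exists>s t. v = s @ Block_x # t \<and> v' = Block_ax # t)"
proof (induction n arbitrary: v')
  case 0
  then show ?case by (simp add: lmul_a_eq_zero_exponent)
next
  case (Suc n)
  obtain v'' m'' where v'': "(lmul_a ^^ Suc n) (NF v m) = NF v'' m''"
    by (metis normal_form.exhaust)
  with Suc.prems have "lmul_a (NF v'' m'') = NF v' 0" by simp
  then obtain s t where st: "m'' = 0" "v'' = s @ Block_x # t" "v' = Block_ax # t"
    using lmul_a_eq_zero_exponent by blast
  with v'' Suc.IH[of v''] obtain s' t' where
    "m = 0" "v = s' @ Block_x # t'" "v'' = Block_ax # t'" by auto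
  moreover from this st have "\<exists>s''. t' = s'' @ Block_x # t"
    by (cases s) auto
  ultimately show ?case using st by (metis append_Cons append_assoc)
qed

text \<open>A product without trailing \<open>a\<close> is either a plain concatenation, or it ends in \<open>ax\<cdot>t\<close> where the
  right factor ends in \<open>x\<cdot>t\<close>. This contrast between \<open>x\<close> and \<open>ax\<close> in front of the same suffix
  separates the two kinds of terms in the proof of complete primality.\<close>

lemma plus_eq_zero_exponent:
  assumes "NF z n + NF v m = NF u 0"
  shows "m = 0"
    and "n = 0 \<and> u = z @ v \<or> (\<exists>s t z'. v = s @ Block_x # t \<and> u = z' @ Block_ax # t)"
proof -
  obtain v' where v': "(lmul_a ^^ n) (NF v m) = NF v' 0" "u = z @ v'"
    using assms by (cases "(lmul_a ^^ n) (NF v m)") auto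
  then have "m = 0 \<and> (n = 0 \<and> u = z @ v
      \<or> (\<exists>s t z'. v = s @ Block_x # t \<and> u = z' @ Block_ax # t))"
    using lmul_a_power_eq_zero_exponent[of _ v m v'] by (cases n) fastforce+
  then show "m = 0"
    and "n = 0 \<and> u = z @ v \<or> (\<exists>s t z'. v = s @ Block_x # t \<and> u = z' @ Block_ax # t)"
    by auto
qed

section \<open>The left ideal generated by \<open>a\<close> is completely prime\<close>

text \<open>Under the identification of \<open>R\<close> with a monoid algebra, this says that an element does not lie
  in the left ideal \<open>Ra\<close>.\<close>

definition has_exponent_zero :: "(normal_form \<Rightarrow>\<^sub>0 'k::zero) \<Rightarrow> bool" where
  "has_exponent_zero f \<longleftrightarrow> (\<exists>w. NF w 0 \<in> Poly_Mapping.keys f)"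

text \<open>Compare words from right to left, with \<open>ax\<close> smaller than \<open>x\<close> and each word smaller than its
  proper extensions to the left. A largest element \<open>w\<close> of \<open>B\<close> has no extension in \<open>B\<close>, and no
  element of \<open>B\<close> has \<open>x\<close> where \<open>w\<close> has \<open>ax\<close> in front of a common suffix.\<close>

lemma exists_right_maximal:
  assumes "finite B" "B \<noteq> {}"
  obtains w where "w \<in> B" "\<And>s. s @ w \<in> B \<Longrightarrow> s = []"
    "\<And>s s' t. s @ Block_x # t \<in> B \<Longrightarrow> w \<noteq> s' @ Block_ax # t"
proof -
  define less where "less u v \<longleftrightarrow> (rev u, rev v) \<in> lexord {(Block_ax, Block_x)}" for u v
  have "asymp_on B less"
  proof (rule asymp_onI)
    have "asym {(Block_ax, Block_x)}" by (rule asymI) auto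
    then show "\<not> less v u" if "less u v" for u v
      using that unfolding less_def by (rule lexord_asymmetric)
  qed
  moreover have "transp_on B less"
    by (rule transp_onI) (unfold less_def, erule (1) lexord_trans, auto intro: transI)
  ultimately have "\<exists>w\<in>B. \<forall>v\<in>B. v \<noteq> w \<longrightarrow> \<not> less w v"
    using assms by (intro Finite_Set.bex_max_element)
  then obtain w where w: "w \<in> B" "\<And>v. v \<in> B \<Longrightarrow> v \<noteq> w \<Longrightarrow> \<not> less w v"
    by blast
  show thesis
  proof
    show "w \<in> B" by fact
    show "s = []" if "s @ w \<in> B" for s
    proof (rule ccontr)
      assume "s \<noteq> []"
      then have "less w (s @ w)"
        unfolding less_def rev_append by (intro lexord_append_rightI) (cases s rule: rev_cases; simp)
      with w(2)[OF that] \<open>s \<noteq> []\<close> show False by simp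
    qed
    show "w \<noteq> s' @ Block_ax # t" if "s @ Block_x # t \<in> B" for s s' t
    proof
      assume w_eq: "w = s' @ Block_ax # t"
      then have "less w (s @ Block_x # t)"
        unfolding less_def by (simp add: lexord_append_left_rightI)
      moreover have "s @ Block_x # t \<noteq> w"
        using calculation by (auto simp: less_def lexord_irreflexive)
      ultimately show False using w(2)[OF that] by simp
    qed
  qed
qed

text \<open>Take \<open>w\<close> largest, in the order of the previous lemma, among the words \<open>w a\<^sup>0\<close> in \<open>f\<close>, and \<open>z\<close>
  longest among the words \<open>z a\<^sup>0\<close> in \<open>y\<close>. The word \<open>z w\<close> then arises only as the product of \<open>z\<close> and
  \<open>w\<close>. A product that converts a block \<open>x\<close> to \<open>ax\<close> cannot end in \<open>w\<close>, by the choice of \<open>w\<close>. A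
  concatenation \<open>z' v = z w\<close> forces \<open>v\<close> to be a suffix of \<open>w\<close>, again by the choice of \<open>w\<close>, and then
  \<open>z'\<close> is at least as long as \<open>z\<close>, so that \<open>z' = z\<close>. The choices of \<open>w\<close> and \<open>z\<close> are
  of different kinds on purpose: with the longest word of \<open>f\<close> in place of \<open>w\<close>, a product with a
  conversion could cancel the term \<open>z w\<close>.\<close>

lemma has_exponent_zero_mult:
  fixes y f :: "normal_form \<Rightarrow>\<^sub>0 'k::semiring_no_zero_divisors"
  assumes "has_exponent_zero y" "has_exponent_zero f"
  shows "has_exponent_zero (y * f)"
proof -
  have finite: "finite {w. NF w 0 \<in> Poly_Mapping.keys g}" for g :: "normal_form \<Rightarrow>\<^sub>0 'k"
    using finite_vimageI[of "Poly_Mapping.keys g" "\<lambda>w. NF w 0"] by (simp add: inj_def vimage_def)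
  obtain w where w: "NF w 0 \<in> Poly_Mapping.keys f"
    and w_max: "\<And>s. NF (s @ w) 0 \<in> Poly_Mapping.keys f \<Longrightarrow> s = []"
      "\<And>s s' t. NF (s @ Block_x # t) 0 \<in> Poly_Mapping.keys f \<Longrightarrow> w \<noteq> s' @ Block_ax # t"
  proof (rule exists_right_maximal[OF finite[of f]])
    show "{w. NF w 0 \<in> Poly_Mapping.keys f} \<noteq> {}"
      using assms(2) by (simp add: has_exponent_zero_def)
  qed (rule that, simp_all)
  obtain z where z: "NF z 0 \<in> Poly_Mapping.keys y"
    and z_max: "\<And>z'. NF z' 0 \<in> Poly_Mapping.keys y \<Longrightarrow> length z' \<le> length z"
  proof -
    let ?L = "length ` {w. NF w 0 \<in> Poly_Mapping.keys y}"
    have "Max ?L \<in> ?L"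
      using assms(1) finite by (intro Max_in) (auto simp: has_exponent_zero_def)
    then obtain z where z: "NF z 0 \<in> Poly_Mapping.keys y" "length z = Max ?L" by auto
    show thesis
      by (rule that[OF z(1)]) (use finite in \<open>auto simp: z(2) intro!: Max_ge\<close>)
  qed
  have "Poly_Mapping.lookup (y * f) (NF z 0 + NF w 0)
      = Poly_Mapping.lookup y (NF z 0) * Poly_Mapping.lookup f (NF w 0)"
  proof (rule lookup_mult_unique)
    fix u v
    assume u: "u \<in> Poly_Mapping.keys y" and v: "v \<in> Poly_Mapping.keys f"
      and eq: "u + v = NF z 0 + NF w 0"
    obtain z' n v' m where uv: "u = NF z' n" "v = NF v' m"
      by (metis normal_form.exhaust)
    have eq': "NF z' n + NF v' m = NF (z @ w) 0" using eq uv by simp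
    have m: "m = 0" using plus_eq_zero_exponent(1)[OF eq'] .
    have v': "NF v' 0 \<in> Poly_Mapping.keys f" using v uv m by simp
    from plus_eq_zero_exponent(2)[OF eq'] show "u = NF z 0 \<and> v = NF w 0"
    proof (elim disjE exE conjE)
      assume n: "n = 0" and "z @ w = z' @ v'"
      then consider s where "v' = s @ w" | s where "z' = z @ s" "w = s @ v'"
        by (auto simp: append_eq_append_conv2)
      then show ?thesis
      proof cases
        case 1
        with w_max(1) v' have "v' = w" by simp
        with \<open>z @ w = z' @ v'\<close> show ?thesis using uv n m by simp
      next
        case 2
        then show ?thesis using z_max[of z'] u uv n m by simp
      qed
    next
      fix s t z''
      assume v'_eq: "v' = s @ Block_x # t" and eq'': "z @ w = z'' @ Block_ax # t"
      from eq'' consider s' where "w = s' @ Block_ax # t" | s' where "Block_ax # t = s' @ w" "s' \<noteq> []"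
        by (auto simp: append_eq_append_conv2) (metis append_Nil)
      then show ?thesis
      proof cases
        case 1
        then show ?thesis using w_max(2) v' v'_eq by blast
      next
        case 2
        then obtain s'' where "t = s'' @ w" by (cases s') auto
        then show ?thesis using w_max(1)[of "s @ Block_x # s''"] v' v'_eq by simp
      qed
    qed
  qed
  moreover have "NF z 0 + NF w 0 = NF (z @ w) 0" by simp
  ultimately show ?thesis
    using w z unfolding has_exponent_zero_def
    by (intro exI[of _ "z @ w"]) (simp add: in_keys_iff del: plus_normal_form.simps)
qed

section \<open>\<open>R\<close> as a monoid algebra\<close>

definition word_R :: "generator list \<Rightarrow> R" where
  "word_R l = abs_R (Poly_Mapping.single (Word l) 1)"

definition x_R :: R where "x_R = abs_R (gen X)"

lemma abs_R_zero: "abs_R 0 = 0" by (simp add: zero_R_def)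
lemma abs_R_one: "abs_R 1 = 1" by (simp add: one_R_def)

lemma abs_R_sum: "abs_R (sum f I) = (\<Sum>i\<in>I. abs_R (f i))"
  by (induction I rule: infinite_finite_induct)
    (simp_all add: abs_R_zero plus_R.abs_eq[symmetric])

lemma bit_nonzero: "c \<noteq> 0 \<Longrightarrow> c = 1" for c :: bit
  by (cases c) auto

text \<open>The nonzero coefficients all equal \<open>1\<close>, so the class of \<open>p\<close> in \<open>R\<close> is simply the sum of the
  words in the support of \<open>p\<close>.\<close>

lemma abs_R_push_forward:
  "abs_R (push_forward h p) = (\<Sum>u\<in>Poly_Mapping.keys p. word_R (letters (h u)))"
  unfolding push_forward_def abs_R_sum word_R_def
  by (rule sum.cong) (auto simp: in_keys_iff dest!: bit_nonzero)

lemma abs_R_expand: "abs_R p = (\<Sum>u\<in>Poly_Mapping.keys p. word_R (letters u))"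
  using abs_R_push_forward[of "\<lambda>u. u" p] by (simp add: push_forward_id)

lemma word_R_Nil [simp]: "word_R [] = 1"
  unfolding word_R_def zero_free_monoid_def[symmetric] single_one abs_R_one ..

lemma word_R_append: "word_R (l @ l') = word_R l * word_R l'"
  unfolding word_R_def times_R.abs_eq by (simp add: mult_single plus_free_monoid_def)

lemma word_R_A: "word_R [A] = a_R" and word_R_X: "word_R [X] = x_R"
  by (simp_all add: word_R_def a_R_def x_R_def gen_def)

lemma word_R_Cons: "word_R (g # l) = word_R [g] * word_R l"
  using word_R_append[of "[g]" l] by simp

lemma word_R_replicate_A: "word_R (replicate n A) = a_R ^ n"
  by (induction n) (simp_all add: word_R_Cons[of _ "replicate _ _"] word_R_A)

lemma a_R_relation: "a_R * (a_R * x_R) = a_R"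
proof -
  have "gen A - (gen A)\<^sup>2 * gen X \<in> R_ideal"
    unfolding R_ideal_def by (rule hull_inc) simp
  then have "abs_R (gen A) = abs_R ((gen A)\<^sup>2 * gen X)"
    by (simp add: R.abs_eq_iff)
  then show ?thesis
    unfolding a_R_def x_R_def times_R.abs_eq power2_eq_square mult.assoc by (rule sym)
qed

lemma a_R_relation_mult: "a_R * (a_R * (x_R * r)) = a_R * r"
  unfolding mult.assoc[symmetric] unfolding a_R_relation[unfolded mult.assoc[symmetric]] ..

text \<open>The free monoid maps onto the normal forms by \<open>nf\<close>, and \<open>nf_word\<close> is a section of this map. The
  relation \<open>a(ax) = a\<close> is all that is needed to bring a word of \<open>R\<close> into normal form, whence
  \<open>word_R_nf\<close>.\<close>

fun letter_nf :: "generator \<Rightarrow> normal_form" where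
  "letter_nf A = NF [] 1"
| "letter_nf X = NF [Block_x] 0"

definition nf :: "generator free_monoid \<Rightarrow> normal_form" where
  "nf u = sum_list (map letter_nf (letters u))"

lemma nf_plus: "nf (u + v) = nf u + nf v"
  by (simp add: nf_def plus_free_monoid_def)

fun block_letters :: "block \<Rightarrow> generator list" where
  "block_letters Block_x = [X]"
| "block_letters Block_ax = [A, X]"

fun nf_word :: "normal_form \<Rightarrow> generator free_monoid" where
  "nf_word (NF w n) = Word (concat (map block_letters w) @ replicate n A)"

lemma word_R_lmul_a: "word_R (letters (nf_word (lmul_a v))) = a_R * word_R (letters (nf_word v))"
proof (induction v rule: lmul_a.induct)
  case (1 n)
  then show ?case by (simp add: word_R_Cons[of _ "replicate _ _"] word_R_A)
next
  case (2 w n)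
  then show ?case by (simp add: word_R_Cons[of _ "_ # _"] word_R_A)
next
  case (3 w n)
  then show ?case
    by (simp add: word_R_Cons[of _ "_ # _"] word_R_Cons[of _ "_ @ _"] word_R_A word_R_X
        a_R_relation_mult)
qed

lemma word_R_nf: "word_R (letters (nf_word (nf (Word l)))) = word_R l"
proof (induction l)
  case Nil
  then show ?case by (simp add: nf_def zero_normal_form_def)
next
  case (Cons g l)
  obtain w n where wn: "nf (Word l) = NF w n" by (metis normal_form.exhaust)
  have "nf (Word (g # l)) = letter_nf g + nf (Word l)" by (simp add: nf_def)
  then show ?case
    using Cons wn word_R_lmul_a[of "nf (Word l)"]
    by (cases g) (simp_all add: word_R_Cons[of _ l] word_R_A
        word_R_Cons[of _ "_ @ _"])
qed

text \<open>The kernel of a ring homomorphism is a two-sided ideal, and this one contains \<open>a - a\<^sup>2x\<close>.\<close>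

lemma push_forward_nf_R_ideal:
  assumes "p \<in> R_ideal"
  shows "push_forward nf p = 0"
proof -
  let ?K = "{p :: (bit, generator) free_algebra. push_forward nf p = 0}"
  have "R_ideal \<subseteq> ?K"
    unfolding R_ideal_def
  proof (rule hull_minimal)
    show "{gen A - (gen A)\<^sup>2 * gen X} \<subseteq> ?K"
      by (simp add: push_forward_diff push_forward_mult nf_plus power2_eq_square gen_def mult_single)
        (simp add: nf_def)
    show "two_sided_ideal ?K"
      by (simp add: two_sided_ideal_def push_forward_add push_forward_mult nf_plus)
  qed
  with assms show ?thesis by auto
qed

lift_definition to_nf :: "R \<Rightarrow> (normal_form \<Rightarrow>\<^sub>0 bit)" is "push_forward nf"
  using push_forward_nf_R_ideal by (metis eq_iff_diff_eq_0 push_forward_diff)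

lemma to_nf_zero [simp]: "to_nf 0 = 0"
  by transfer simp

lemma to_nf_one: "to_nf 1 = 1"
  by transfer (rule push_forward_one, simp add: nf_def zero_free_monoid_def)

lemma to_nf_mult: "to_nf (r * s) = to_nf r * to_nf s"
  by transfer (rule push_forward_mult[OF nf_plus])

lemma to_nf_a_R: "to_nf a_R = Poly_Mapping.single (NF [] 1) 1"
  by transfer (simp add: gen_def nf_def)

text \<open>This left inverse makes \<open>to_nf\<close> injective.\<close>

lemma abs_R_to_nf: "abs_R (push_forward nf_word (to_nf r)) = r"
proof (induction r rule: R.abs_induct)
  case (1 p)
  have "word_R (letters (nf_word (nf u))) = word_R (letters u)" for u
    using word_R_nf[of "letters u"] by simp
  then have "abs_R (push_forward nf_word (push_forward nf p)) = abs_R p"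
    unfolding push_forward_push_forward abs_R_push_forward abs_R_expand[of p] by simp
  then show ?case by (simp only: to_nf.abs_eq)
qed

text \<open>Every term of \<open>r\<close> ends in \<open>a\<close>, so one \<open>a\<close> can be split off from each.\<close>

lemma not_has_exponent_zero_imp:
  assumes "\<not> has_exponent_zero (to_nf r)"
  obtains s where "r = s * a_R"
proof -
  have "word_R (letters (nf_word v)) = word_R (letters (nf_word (case v of NF w n \<Rightarrow> NF w (n - 1)))) * a_R"
    if v: "v \<in> Poly_Mapping.keys (to_nf r)" for v
  proof -
    obtain w n where "v = NF w (Suc n)"
      using assms v unfolding has_exponent_zero_def by (metis normal_form.exhaust not0_implies_Suc)
    then show ?thesis
      by (simp add: word_R_append word_R_replicate_A mult.assoc flip: power_Suc2 replicate_Suc)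
  qed
  then have "r = (\<Sum>v\<in>Poly_Mapping.keys (to_nf r).
      word_R (letters (nf_word (case v of NF w n \<Rightarrow> NF w (n - 1))))) * a_R"
    by (subst abs_R_to_nf[symmetric]) (simp add: abs_R_push_forward sum_distrib_right)
  then show thesis using that by blast
qed

text \<open>Appending \<open>a\<close> to a normal form gives a normal form, and distinct ones stay distinct.\<close>

lemma a_R_right_cancel:
  assumes "s * a_R = 0"
  shows "s = 0"
proof -
  have "Poly_Mapping.lookup (to_nf s) v = 0" for v
  proof -
    have "Poly_Mapping.lookup (to_nf s * to_nf a_R) (v + NF [] 1)
        = Poly_Mapping.lookup (to_nf s) v * Poly_Mapping.lookup (to_nf a_R) (NF [] 1)"
    proof (rule lookup_mult_unique)
      fix u v'
      assume "v' \<in> Poly_Mapping.keys (to_nf a_R)" and eq: "u + v' = v + NF [] 1"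
      then have "v' = NF [] 1" by (simp add: to_nf_a_R)
      with eq show "u = v \<and> v' = NF [] 1"
        by (cases u; cases v) (simp add: plus_a del: plus_normal_form.simps)
    qed
    moreover have "to_nf s * to_nf a_R = 0"
      using assms by (metis to_nf_mult to_nf_zero)
    ultimately have "0 = Poly_Mapping.lookup (to_nf s) v * Poly_Mapping.lookup (to_nf a_R) (NF [] 1)"
      by (simp only: lookup_zero)
    also have "Poly_Mapping.lookup (to_nf a_R) (NF [] 1) = 1" by (simp add: to_nf_a_R)
    finally show ?thesis by (simp only: mult_1_right)
  qed
  then have "to_nf s = 0" by (simp add: poly_mapping_eqI)
  then show ?thesis using abs_R_to_nf[of s] by (simp add: abs_R_zero)
qed

lemma a_R_power_right_cancel: "s * a_R ^ n = 0 \<Longrightarrow> s = 0"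
proof (induction n)
  case (Suc n)
  then have "(s * a_R ^ n) * a_R = 0" by (simp only: power_Suc2 mult.assoc)
  then show ?case by (rule Suc.IH[OF a_R_right_cancel])
qed simp

section \<open>Nilpotent elements\<close>

text \<open>Since \<open>1\<close> is not in \<open>Ra\<close> either, complete primality keeps all powers of an element outside \<open>Ra\<close>
  outside \<open>Ra\<close>, and so away from \<open>0\<close>.\<close>

lemma nilpotent_imp_right_multiple_a:
  assumes "r \<in> nilpotents"
  obtains s where "r = s * a_R"
proof -
  have "has_exponent_zero (to_nf (r ^ n))" if "has_exponent_zero (to_nf r)" for n
  proof (induction n)
    case 0
    then show ?case
      by (simp add: to_nf_one has_exponent_zero_def zero_normal_form_def)
  next
    case (Suc n)
    then show ?case using that by (simp add: to_nf_mult has_exponent_zero_mult)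
  qed
  moreover obtain n where "r ^ n = 0" using assms by (auto simp: nilpotents_def)
  ultimately have "has_exponent_zero (to_nf r) \<Longrightarrow> has_exponent_zero (to_nf 0)" by metis
  then have "\<not> has_exponent_zero (to_nf r)" by (auto simp: has_exponent_zero_def)
  then show thesis using that by (rule not_has_exponent_zero_imp)
qed

lemma nilpotents_swap:
  fixes s t :: "'a::ring_1"
  assumes "s * t \<in> nilpotents"
  shows "t * s \<in> nilpotents"
proof -
  obtain n where n: "(s * t) ^ n = 0" using assms by (auto simp: nilpotents_def)
  have "(t * s) ^ Suc n = t * (s * t) ^ n * s" for n
  proof (induction n)
    case (Suc n)
    have "(t * s) ^ Suc (Suc n) = (t * s) * (t * (s * t) ^ n * s)"
      by (simp only: power_Suc[of _ "Suc n"] Suc)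
    then show ?case by (simp only: power_Suc mult.assoc)
  qed simp
  then have "(t * s) ^ Suc n = 0" by (simp only: n mult_zero_right mult_zero_left)
  then show ?thesis
    unfolding nilpotents_def by (intro CollectI exI[of _ "Suc n"] conjI) simp_all
qed

text \<open>The grading of \<open>R\<close> with \<open>a\<close> in degree \<open>1\<close> and \<open>x\<close> in degree \<open>-1\<close>; the Laurent polynomials are
  the monoid algebra of the integers.\<close>

definition word_degree :: "generator list \<Rightarrow> int" where
  "word_degree l = (\<Sum>g\<leftarrow>l. case g of A \<Rightarrow> 1 | X \<Rightarrow> - 1)"

definition laurent :: "(bit, generator) free_algebra \<Rightarrow> (int \<Rightarrow>\<^sub>0 bit)" where
  "laurent = push_forward (word_degree \<circ> letters)"

lemma laurent_mult: "laurent (p * q) = laurent p * laurent q"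
  unfolding laurent_def
  by (rule push_forward_mult) (simp add: word_degree_def plus_free_monoid_def)

lemma laurent_one: "laurent 1 = 1"
  unfolding laurent_def
  by (rule push_forward_one) (simp add: word_degree_def zero_free_monoid_def)

lemma laurent_power: "laurent (p ^ n) = laurent p ^ n"
  by (induction n) (simp_all add: laurent_one laurent_mult)

lemma laurent_R_ideal:
  assumes "p \<in> R_ideal"
  shows "laurent p = 0"
proof -
  let ?K = "{p. laurent p = 0}"
  have "R_ideal \<subseteq> ?K"
    unfolding R_ideal_def
  proof (rule hull_minimal)
    show "{gen A - (gen A)\<^sup>2 * gen X} \<subseteq> ?K"
      by (simp add: laurent_def push_forward_diff gen_def power2_eq_square mult_single)
        (simp add: word_degree_def plus_free_monoid_def)
    show "two_sided_ideal ?K"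
      by (simp add: two_sided_ideal_def laurent_mult) (simp add: laurent_def push_forward_add)
  qed
  with assms show ?thesis by auto
qed

text \<open>With enough factors \<open>a\<close> to the left, every \<open>x\<close> meets \<open>aa\<close> and cancels one of them. The strict
  inequality leaves one factor \<open>a\<close> over, without which \<open>ax\<close> would not simplify.\<close>

lemma a_power_mult_word_R:
  assumes "length l < k"
  shows "a_R ^ k * word_R l = a_R ^ nat (int k + word_degree l)"
  using assms
proof (induction l arbitrary: k)
  case Nil
  then show ?case by (simp add: word_degree_def)
next
  case (Cons g l)
  show ?case
  proof (cases g)
    case A
    have "a_R ^ k * word_R (g # l) = a_R ^ Suc k * word_R l"
      by (simp add: A word_R_Cons[of _ l] word_R_A power_commutes flip: mult.assoc)
    also have "\<dots> = a_R ^ nat (int (Suc k) + word_degree l)"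
      using Cons.prems by (intro Cons.IH) simp
    finally show ?thesis by (simp add: A word_degree_def algebra_simps)
  next
    case X
    obtain j where k: "k = Suc (Suc j)" and j: "length l < Suc j"
      using Cons.prems by (auto simp: less_iff_Suc_add)
    have "a_R ^ k * word_R (g # l) = a_R ^ j * (a_R * (a_R * (x_R * word_R l)))"
      unfolding X k word_R_Cons[of _ l] word_R_X power_Suc2 mult.assoc ..
    also have "\<dots> = a_R ^ Suc j * word_R l"
      unfolding a_R_relation_mult power_Suc2 mult.assoc ..
    also have "\<dots> = a_R ^ nat (int (Suc j) + word_degree l)"
      using j by (rule Cons.IH)
    finally show ?thesis by (simp add: X k word_degree_def algebra_simps)
  qed
qed

text \<open>For large \<open>k\<close> the product \<open>a\<^sup>k r\<close> is the value at \<open>a\<close> of the Laurent polynomial of \<open>r\<close> with all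
  exponents raised by \<open>k\<close>, and this Laurent polynomial is nilpotent in a domain.\<close>

lemma nilpotent_imp_annihilated:
  assumes "r \<in> nilpotents"
  obtains k where "a_R ^ k * r = 0"
proof -
  have "\<exists>p. r = abs_R p" by (induction r rule: R.abs_induct) blast
  then obtain p where r: "r = abs_R p" ..
  obtain n where "r ^ n = 0" using assms by (auto simp: nilpotents_def)
  moreover have "abs_R p ^ n = abs_R (p ^ n)" for n
    by (induction n) (simp_all add: abs_R_one times_R.abs_eq)
  ultimately have "abs_R (p ^ n) = abs_R 0" by (simp add: r abs_R_zero)
  then have "p ^ n \<in> R_ideal" by (simp add: R.abs_eq_iff)
  then have "laurent p ^ n = 0" using laurent_R_ideal by (metis laurent_power)
  then have "laurent p = 0" by simp
  \<comment> \<open>Any \<open>k\<close> above the lengths of all words in the support would do.\<close>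
  define k where "k = Suc (\<Sum>u\<in>Poly_Mapping.keys p. length (letters u))"
  let ?shift = "\<lambda>d. Word (replicate (nat (int k + d)) A)"
  have "a_R ^ k * word_R (letters u) = word_R (letters (?shift (word_degree (letters u))))"
    if "u \<in> Poly_Mapping.keys p" for u
  proof -
    have "length (letters u) < k"
      unfolding k_def less_Suc_eq_le using that by (intro member_le_sum) auto
    then show ?thesis by (simp add: a_power_mult_word_R word_R_replicate_A)
  qed
  then have "a_R ^ k * r = abs_R (push_forward (?shift \<circ> (word_degree \<circ> letters)) p)"
    unfolding r abs_R_push_forward by (simp add: abs_R_expand sum_distrib_left)
  also have "\<dots> = abs_R (push_forward ?shift (laurent p))"
    by (simp add: push_forward_push_forward laurent_def)
  also have "\<dots> = 0"
    by (simp add: \<open>laurent p = 0\<close> abs_R_zero)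
  finally show thesis by (rule that)
qed

text \<open>The sequences in the definition of \<open>Nr\<close>, normalised to vanish from some point on. In this form
  two sequences can be given a common bound, and nilpotency of \<open>r\<close> is automatic, so that it need not
  be carried along when sequences are combined.\<close>

definition descends :: "'a::ring_1 \<Rightarrow> 'a \<Rightarrow> (nat \<Rightarrow> 'a) \<Rightarrow> nat \<Rightarrow> bool" where
  "descends a r s k \<longleftrightarrow> r = s 1 * a \<and> (\<forall>i\<ge>1. a * s i = s (i + 1) * a) \<and> (\<forall>i>k. s i = 0)"

lemma descends_mono: "descends a r s k \<Longrightarrow> k \<le> l \<Longrightarrow> descends a r s l"
  by (auto simp: descends_def)

lemma descends_imp_power_mult:
  assumes "descends a r s k"
  shows "a ^ i * r = s (i + 1) * a ^ (i + 1)"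
proof (induction i)
  case (Suc i)
  have "a ^ Suc i * r = a * s (i + 1) * a ^ (i + 1)"
    using Suc by (simp add: mult.assoc)
  also have "a * s (i + 1) = s (Suc i + 1) * a" using assms by (simp add: descends_def)
  finally show ?case by (simp add: mult.assoc)
qed (use assms in \<open>simp add: descends_def\<close>)

text \<open>Moving the powers of \<open>a\<close> to the right gives \<open>r\<^sup>i = s\<^sub>1 \<cdots> s\<^sub>i a\<^sup>i\<close>, and \<open>a\<^sup>k r = 0\<close>.\<close>

lemma descends_imp_nilpotent:
  assumes "descends a r s k"
  shows "r \<in> nilpotents"
proof -
  have "\<exists>t. r ^ i = t * a ^ i" for i
  proof (induction i)
    case (Suc i)
    then obtain t where "r ^ i = t * a ^ i" ..
    then have "r ^ Suc i = t * (a ^ i * r)" by (simp only: power_Suc2 mult.assoc)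
    then show ?case
      unfolding descends_imp_power_mult[OF assms]
      by (intro exI[of _ "t * s (i + 1)"]) (simp only: mult.assoc Suc_eq_plus1)
  qed simp
  then obtain t where t: "r ^ k = t * a ^ k" by blast
  have "r ^ Suc k = t * (a ^ k * r)" using t by (simp only: power_Suc2 mult.assoc)
  also have "\<dots> = 0"
    unfolding descends_imp_power_mult[OF assms] using assms by (simp add: descends_def)
  finally show ?thesis unfolding nilpotents_def by (intro CollectI exI[of _ "Suc k"]) simp
qed

text \<open>A sequence with \<open>a s\<^sub>k = 0\<close> may be replaced by \<open>0\<close> after index \<open>k\<close>, even if its own later members
  do not vanish.\<close>

lemma Nr_eq_descends:
  fixes a :: "'a::ring_1"
  shows "Nr a = {r. \<exists>s k. descends a r s k}"
proof (intro equalityI subsetI CollectI; (elim CollectE exE)?)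
  fix r assume "r \<in> Nr a"
  then obtain s :: "nat \<Rightarrow> 'a" and k where s: "r = s 1 * a" "\<forall>i\<ge>1. a * s i = s (i + 1) * a"
    and k: "k \<ge> 1" "a * s k = 0"
    unfolding Nr_def by blast
  have "descends a r (\<lambda>i. if i \<le> k then s i else 0) k"
    unfolding descends_def
  proof (intro conjI allI impI)
    show "a * (if i \<le> k then s i else 0) = (if i + 1 \<le> k then s (i + 1) else 0) * a"
      if "i \<ge> 1" for i
    proof -
      have "a * s i = s (i + 1) * a" using s(2) that by blast
      then show ?thesis using k(2) by (cases i k rule: linorder_cases) simp_all
    qed
  qed (use s(1) k(1) in simp_all)
  then show "\<exists>s k. descends a r s k" by blast
next
  fix r s k assume desc: "descends a r s k"
  then have "a * s (Suc k) = 0" by (simp add: descends_def)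
  then show "r \<in> Nr a"
    unfolding Nr_def using desc descends_imp_nilpotent[OF desc]
    by (auto simp: descends_def intro!: exI[of _ s] exI[of _ "Suc k"])
qed

text \<open>For the product, \<open>xy = s\<^sub>1 a t\<^sub>1 a = s\<^sub>1 t\<^sub>2 a a\<close> suggests the sequence \<open>s\<^sub>i t\<^bsub>i+1\<^esub> a\<close>.\<close>

lemma Nr_nonunital_subring: "nonunital_subring (Nr a)"
  unfolding nonunital_subring_def
proof (intro conjI ballI)
  have "descends a 0 (\<lambda>_. 0) 0" by (simp add: descends_def)
  then show "0 \<in> Nr a" unfolding Nr_eq_descends by blast
next
  fix x y assume "x \<in> Nr a" "y \<in> Nr a"
  then obtain s k t l where "descends a x s k" "descends a y t l"
    unfolding Nr_eq_descends by blast
  then have s: "descends a x s (max k l)" and t: "descends a y t (max k l)"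
    by (auto elim: descends_mono)
  have "descends a (x - y) (\<lambda>i. s i - t i) (max k l)"
    using s t by (simp add: descends_def algebra_simps)
  then show "x - y \<in> Nr a" unfolding Nr_eq_descends by blast
  have a_s: "a * s i = s (i + 1) * a" and a_t: "a * t i = t (i + 1) * a" if "i \<ge> 1" for i
    using s t that by (simp_all add: descends_def)
  have "descends a (x * y) (\<lambda>i. s i * (t (i + 1) * a)) (max k l)"
    unfolding descends_def
  proof (intro conjI allI impI)
    have "x * y = (s 1 * a) * (t 1 * a)"
      using s t by (simp only: descends_def)
    also have "\<dots> = s 1 * (a * t 1) * a"
      by (simp only: mult.assoc)
    finally show "x * y = s 1 * (t (1 + 1) * a) * a"
      by (simp only: a_t le_refl)
    show "a * (s i * (t (i + 1) * a)) = s (i + 1) * (t (i + 1 + 1) * a) * a" if "i \<ge> 1" for i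
    proof -
      have "a * (s i * (t (i + 1) * a)) = (a * s i) * t (i + 1) * a"
        by (simp only: mult.assoc)
      also have "\<dots> = s (i + 1) * (a * t (i + 1)) * a"
        by (simp only: a_s[OF that] mult.assoc)
      finally show ?thesis by (simp only: a_t le_add2)
    qed
    show "s i * (t (i + 1) * a) = 0" if "max k l < i" for i
      using s that by (simp add: descends_def)
  qed
  then show "x * y \<in> Nr a" unfolding Nr_eq_descends by blast
qed

text \<open>Given nilpotent \<open>s\<^sub>i a\<close>, the element \<open>a s\<^sub>i\<close> is nilpotent by \<open>nilpotents_swap\<close> and hence a
  right multiple \<open>s\<^bsub>i+1\<^esub> a\<close>. The sequence is indexed from \<open>0\<close> here and shifted at the end.\<close>

lemma nilpotents_R: "(nilpotents :: R set) = Nr a_R"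
proof (intro equalityI subsetI)
  fix r :: R assume r: "r \<in> nilpotents"
  have "\<exists>s. s * a_R \<in> nilpotents \<and> r = s * a_R"
    using r nilpotent_imp_right_multiple_a by metis
  moreover have "\<exists>s'. s' * a_R \<in> nilpotents \<and> a_R * s = s' * a_R"
    if "s * a_R \<in> nilpotents" for s
    using nilpotents_swap[OF that] nilpotent_imp_right_multiple_a by metis
  ultimately have "\<exists>s. \<forall>i. (s i * a_R \<in> nilpotents \<and> (i = 0 \<longrightarrow> r = s i * a_R))
      \<and> a_R * s i = s (Suc i) * a_R"
    by (intro dependent_nat_choice) auto
  then obtain s where s: "r = s 0 * a_R" "\<And>i. a_R * s i = s (Suc i) * a_R"
    by blast
  have pow: "a_R ^ i * r = s i * a_R ^ Suc i" for i
  proof (induction i)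
    case (Suc i)
    then show ?case by (simp add: mult.assoc) (simp add: s(2) flip: mult.assoc)
  qed (simp add: s)
  obtain k where "a_R ^ k * r = 0" using r nilpotent_imp_annihilated by blast
  then have "s k * a_R ^ Suc k = 0" by (simp add: pow)
  then have "s k = 0" by (rule a_R_power_right_cancel)
  show "r \<in> Nr a_R"
    unfolding Nr_def
  proof (intro CollectI conjI exI[of _ "\<lambda>i. s (i - 1)"] exI[of _ "Suc k"] allI impI)
    show "a_R * s (i - 1) = s (i + 1 - 1) * a_R" if "i \<ge> 1" for i
      using s(2)[of "i - 1"] that by simp
  qed (use r s(1) \<open>s k = 0\<close> in simp_all)
qed (simp add: Nr_def)

theorem theorem3p4:
  shows "(nilpotents :: R set) = Nr a_R \<and> NR_ring TYPE(R)"
  unfolding NR_ring_def nilpotents_R by (simp add: Nr_nonunital_subring)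

end
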